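(* Let $r,N$ be integers with $N>r>0$ and let $A=\{A(i,j)\}_{i,j=1}^N$ be an invertible lower band matrix of order $r$. Let $0<\mu<1$ and assume that $A$ satisfies the strong dominance condition $$\mu|A(k,k)|\ \geq\ \sum_{i=1}^{k-1}|A(i,k)|+\sum_{i=k+1}^{k+r}|A(i,k)|,\qquad k=1,2,\dots,N .$$ Set $\gamma=\mu^{1/r}$ and $$M=\frac{1+\mu^2}{(1-\mu)(1-\mu^2)\min_{1\le i\le N}|A(i,i)|}.$$ Then for all $1\le j\le i\le N$, $$|(A^{-1})(i,j)|\le M\gamma^{\,i-j}.$$
   Context: Matrices have scalar (real or complex) entries, and $(A^{-1})(i,j)$ denotes the scalar entry of $A^{-1}$ in position $(i,j)$. A matrix $A=\{A(i,j)\}_{i,j=1}^N$ is a lower band matrix of order $r$ if $A(i,j)=0$ for $i-j>r$ (no band condition is imposed on the upper triangular part). Entries $A(i,k)$ with row index $i>N$ are understood to be absent (zero) in sums. *)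

theory Defs
  imports Complex_Main "Jordan_Normal_Form.Gauss_Jordan_Elimination"
begin

(* No condition is imposed on the upper triangular part. *)
definition lower_band_mat :: "nat \<Rightarrow> 'a :: zero mat \<Rightarrow> bool" where
  "lower_band_mat r A \<longleftrightarrow>
     (\<forall>i < dim_row A. \<forall>j < dim_col A. i > j + r \<longrightarrow> A $$ (i, j) = 0)"

(* mat_inverse is option-valued; this says that for an invertible matrix
   "the (mat_inverse A)" is the two-sided inverse. *)
lemma the_mat_inverse:
  fixes A :: "'a :: field mat"
  assumes A: "A \<in> carrier_mat n n" and inv: "invertible_mat A"
  shows "the (mat_inverse A) \<in> carrier_mat n n"
    and "inverts_mat A (the (mat_inverse A))"
    and "inverts_mat (the (mat_inverse A)) A"
proof -
  from inv obtain B where AB: "A * B = 1\<^sub>m (dim_row A)" and BA: "B * A = 1\<^sub>m (dim_row B)"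
    unfolding invertible_mat_def inverts_mat_def by auto
  have "dim_col B = n"
    using arg_cong[OF AB, of dim_col] A by auto
  moreover have "dim_row B = n"
    using arg_cong[OF BA, of dim_col] A by auto
  ultimately have B: "B \<in> carrier_mat n n" by auto
  have "A \<in> Units (ring_mat TYPE('a) n ())"
    using A B AB BA unfolding Units_def ring_mat_def by auto
  then obtain C where C: "mat_inverse A = Some C"
    using mat_inverse(1)[OF A, where b = "()"] by (cases "mat_inverse A") auto
  from mat_inverse(2)[OF A C] A C
  show "the (mat_inverse A) \<in> carrier_mat n n"
    and "inverts_mat A (the (mat_inverse A))"
    and "inverts_mat (the (mat_inverse A)) A"
    unfolding inverts_mat_def by auto
qed

end

theory Submission
  imports Defs
begin

text \<open>
  Fix a column \<open>x\<close> of the inverse, so that \<open>A x\<close> is the \<open>j\<close>-th unit vector, and rescale it to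
  \<open>y i = A (i, i) * x i\<close>. Row \<open>i\<close> of the system expresses \<open>y i\<close> by the off-diagonal terms
  \<open>A (i, k) * x k\<close>. Dominance is a condition on columns, so it bounds the \<open>l\<^sup>1\<close> norm: summing
  over \<open>i\<close>, the off-diagonal terms contribute at most \<open>\<mu>\<close> times the \<open>l\<^sup>1\<close> norm of \<open>y\<close>, whence
  that norm is at most \<open>1 / (1 - \<mu>)\<close>.

  The decay comes from applying the same estimate to the tails \<open>T s\<close>, the sums of \<open>norm (y i)\<close>
  over \<open>i \<ge> s\<close>. By the band condition the rows from \<open>s\<close> on only see the unknowns from \<open>s - r\<close> on,
  so \<open>T s \<le> \<mu> * T (s - r)\<close> once \<open>s > j\<close> (lemma \<open>dominant_band_tail_step\<close>). Each factor
  \<open>\<mu> = \<gamma> ^ r\<close> thus pays for \<open>r\<close> steps away from the diagonal, and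
  \<open>T s \<le> \<gamma> ^ (s - j) / (1 - \<mu>)\<close> (lemma \<open>dominant_band_tail_decay\<close>). Dividing by \<open>norm (A (i, i))\<close>
  gives the bound on the inverse with the constant \<open>1 / ((1 - \<mu>) * min)\<close>, which is at most
  \<open>M\<close> because \<open>1 - \<mu>\<^sup>2 \<le> 1 + \<mu>\<^sup>2\<close>.
\<close>

definition weighted_tail ::
    "nat \<Rightarrow> (nat \<Rightarrow> nat \<Rightarrow> 'a :: real_normed_field) \<Rightarrow> (nat \<Rightarrow> 'a) \<Rightarrow> nat \<Rightarrow> real" where
  "weighted_tail N a x s = (\<Sum>i \<in> {s..<N}. norm (a i i) * norm (x i))"

lemma weighted_tail_antimono: "s \<le> t \<Longrightarrow> weighted_tail N a x t \<le> weighted_tail N a x s"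
  unfolding weighted_tail_def by (intro sum_mono2) auto

lemma weighted_entry_le_tail:
  "i < N \<Longrightarrow> norm (a i i) * norm (x i) \<le> weighted_tail N a x i"
  unfolding weighted_tail_def by (intro member_le_sum) auto

text \<open>
  Solving row \<open>i\<close> for its diagonal term and exchanging the two summations turns row equations into
  column sums, where dominance applies. For \<open>s \<le> r\<close> the truncated difference \<open>s - r\<close> is \<open>0\<close>,
  which is right: then all unknowns may occur in the rows from \<open>s\<close> on.
\<close>

lemma dominant_band_tail_step:
  fixes a :: "nat \<Rightarrow> nat \<Rightarrow> 'a :: real_normed_field"
  assumes dom: "\<And>k. k < N \<Longrightarrow> (\<Sum>i \<in> {..<N} - {k}. norm (a i k)) \<le> \<mu> * norm (a k k)"
    and band: "\<And>i k. i < N \<Longrightarrow> k < N \<Longrightarrow> i > k + r \<Longrightarrow> a i k = 0"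
    and eq: "\<And>i. i < N \<Longrightarrow> (\<Sum>k<N. a i k * x k) = b i"
  shows "weighted_tail N a x s \<le> (\<Sum>i \<in> {s..<N}. norm (b i)) + \<mu> * weighted_tail N a x (s - r)"
proof -
  define off where "off i k = (if i = k then 0 else norm (a i k))" for i k
  have row: "norm (a i i) * norm (x i) \<le> norm (b i) + (\<Sum>k \<in> {s - r..<N}. off i k * norm (x k))"
    if i: "i \<in> {s..<N}" for i
  proof -
    have "b i = a i i * x i + (\<Sum>k \<in> {..<N} - {i}. a i k * x k)"
      using eq[of i] i by (simp add: sum.remove[of "{..<N}" i])
    then have "a i i * x i = b i - (\<Sum>k \<in> {..<N} - {i}. a i k * x k)"
      by (simp add: algebra_simps)
    then have "norm (a i i) * norm (x i) = norm (b i - (\<Sum>k \<in> {..<N} - {i}. a i k * x k))"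
      by (metis norm_mult)
    also have "\<dots> \<le> norm (b i) + (\<Sum>k \<in> {..<N} - {i}. norm (a i k * x k))"
      by (intro order.trans[OF norm_triangle_ineq4] add_left_mono norm_sum)
    also have "(\<Sum>k \<in> {..<N} - {i}. norm (a i k * x k)) = (\<Sum>k<N. off i k * norm (x k))"
      by (intro sum.mono_neutral_cong_left) (auto simp: off_def norm_mult)
    also have "\<dots> = (\<Sum>k \<in> {s - r..<N}. off i k * norm (x k))"
    proof (intro sum.mono_neutral_right ballI)
      fix k assume k: "k \<in> {..<N} - {s - r..<N}"
      then have "a i k = 0" using i by (intro band) auto
      then show "off i k * norm (x k) = 0" by (simp add: off_def)
    qed auto
    finally show ?thesis .
  qed
  have column: "(\<Sum>i \<in> {s..<N}. off i k) \<le> \<mu> * norm (a k k)" if "k < N" for k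
  proof -
    have "(\<Sum>i \<in> {s..<N}. off i k) \<le> (\<Sum>i<N. off i k)"
      by (intro sum_mono2) (auto simp: off_def)
    also have "\<dots> = (\<Sum>i \<in> {..<N} - {k}. norm (a i k))"
      by (intro sum.mono_neutral_cong_right) (auto simp: off_def)
    finally show ?thesis using dom[OF that] by simp
  qed
  have "weighted_tail N a x s
      \<le> (\<Sum>i \<in> {s..<N}. norm (b i) + (\<Sum>k \<in> {s - r..<N}. off i k * norm (x k)))"
    unfolding weighted_tail_def by (intro sum_mono row)
  also have "\<dots> = (\<Sum>i \<in> {s..<N}. norm (b i))
      + (\<Sum>k \<in> {s - r..<N}. (\<Sum>i \<in> {s..<N}. off i k) * norm (x k))"
    by (simp add: sum.distrib sum_distrib_right sum.swap[of _ "{s - r..<N}"])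
  also have "\<dots> \<le> (\<Sum>i \<in> {s..<N}. norm (b i))
      + (\<Sum>k \<in> {s - r..<N}. (\<mu> * norm (a k k)) * norm (x k))"
    by (intro add_left_mono sum_mono mult_right_mono column) auto
  also have "\<dots> = (\<Sum>i \<in> {s..<N}. norm (b i)) + \<mu> * weighted_tail N a x (s - r)"
    by (simp add: weighted_tail_def sum_distrib_left mult.assoc)
  finally show ?thesis .
qed

text \<open>
  Taking \<open>s = 0\<close> in the tail estimate bounds the whole sum by itself times \<open>\<mu> < 1\<close>, plus \<open>1\<close>; this
  starts an induction on \<open>s\<close> in steps of \<open>r\<close>. For \<open>s \<le> j\<close> the exponent \<open>s - j\<close> is \<open>0\<close> and the claim
  is that first bound.
\<close>

lemma dominant_band_tail_decay:
  fixes a :: "nat \<Rightarrow> nat \<Rightarrow> 'a :: real_normed_field"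
  assumes "r > 0" and \<mu>: "0 \<le> \<mu>" "\<mu> < 1" and \<gamma>: "0 \<le> \<gamma>" "\<gamma> \<le> 1" "\<gamma> ^ r = \<mu>"
    and dom: "\<And>k. k < N \<Longrightarrow> (\<Sum>i \<in> {..<N} - {k}. norm (a i k)) \<le> \<mu> * norm (a k k)"
    and band: "\<And>i k. i < N \<Longrightarrow> k < N \<Longrightarrow> i > k + r \<Longrightarrow> a i k = 0"
    and eq: "\<And>i. i < N \<Longrightarrow> (\<Sum>k<N. a i k * x k) = (if i = j then 1 else 0)"
  shows "weighted_tail N a x s \<le> \<gamma> ^ (s - j) / (1 - \<mu>)"
proof (induction s rule: less_induct)
  case (less s)
  have step: "weighted_tail N a x t
      \<le> (\<Sum>i \<in> {t..<N}. norm (if i = j then 1 else 0 :: 'a)) + \<mu> * weighted_tail N a x (t - r)" for t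
    using dom band eq by (rule dominant_band_tail_step)
  show ?case
  proof (cases "s \<le> j")
    case True
    have "(\<Sum>i \<in> {0..<N}. norm (if i = j then 1 else 0 :: 'a))
        = (\<Sum>i \<in> {0..<N}. if i = j then 1 else 0)"
      by (intro sum.cong) auto
    also have "\<dots> \<le> (1 :: real)" by simp
    finally have "weighted_tail N a x 0 \<le> 1 + \<mu> * weighted_tail N a x 0"
      using step[of 0] by simp
    then have "weighted_tail N a x 0 \<le> 1 / (1 - \<mu>)"
      using \<mu> by (simp add: field_simps)
    then show ?thesis
      using weighted_tail_antimono[of 0 s N a x] True by simp
  next
    case False
    have "(\<Sum>i \<in> {s..<N}. norm (if i = j then 1 else 0 :: 'a)) = 0"
      using False by (intro sum.neutral) auto
    then have "weighted_tail N a x s \<le> \<mu> * weighted_tail N a x (s - r)"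
      using step[of s] by simp
    also have "\<dots> \<le> \<gamma> ^ r * (\<gamma> ^ (s - r - j) / (1 - \<mu>))"
      unfolding \<gamma>(3) using less.IH[of "s - r"] False \<open>r > 0\<close> \<mu> by (intro mult_left_mono) auto
    also have "\<dots> = \<gamma> ^ (r + (s - r - j)) / (1 - \<mu>)"
      by (simp add: power_add)
    also have "\<dots> \<le> \<gamma> ^ (s - j) / (1 - \<mu>)"
      using \<gamma> \<mu> by (intro divide_right_mono power_decreasing) auto
    finally show ?thesis .
  qed
qed

text \<open>
  A zero on the diagonal would, by dominance, force its whole column to vanish, which no left
  inverse tolerates.
\<close>

lemma dominant_left_invertible_diag_nonzero:
  fixes A :: "'a :: real_normed_field mat"
  assumes A: "A \<in> carrier_mat N N" and X: "X \<in> carrier_mat N N" and XA: "X * A = 1\<^sub>m N"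
    and dom: "(\<Sum>i \<in> {..<N} - {k}. norm (A $$ (i, k))) \<le> \<mu> * norm (A $$ (k, k))"
    and k: "k < N"
  shows "A $$ (k, k) \<noteq> 0"
proof
  assume zero: "A $$ (k, k) = 0"
  have "(\<Sum>i \<in> {..<N} - {k}. norm (A $$ (i, k))) = 0"
    using dom zero by (intro antisym sum_nonneg) auto
  then have "\<forall>i \<in> {..<N} - {k}. norm (A $$ (i, k)) = 0"
    by (subst (asm) sum_nonneg_eq_0_iff) auto
  then have "A $$ (i, k) = 0" if "i < N" for i
    using zero that by (cases "i = k") auto
  then have "(X * A) $$ (k, k) = 0"
    using A X k by (auto simp: scalar_prod_def intro!: sum.neutral)
  then show False using XA k by simp
qed

theorem theorem3p2:
  fixes r N :: nat
    and A :: "'a :: real_normed_field mat"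
    and \<mu> \<gamma> M :: real
  assumes "N > r" and "r > 0"
    and "A \<in> carrier_mat N N"
    and "invertible_mat A"
    and "lower_band_mat r A"
    and "0 < \<mu>" and "\<mu> < 1"
    and dominance: "\<forall>k < N. \<mu> * norm (A $$ (k, k)) \<ge>
           (\<Sum>i \<in> {..<k}. norm (A $$ (i, k)))
         + (\<Sum>i \<in> {k<..k + r} \<inter> {..<N}. norm (A $$ (i, k)))"
    and "\<gamma> = \<mu> powr (1 / real r)"
    and "M = (1 + \<mu>^2) /
           ((1 - \<mu>) * (1 - \<mu>^2) * Min ((\<lambda>i. norm (A $$ (i, i))) ` {..<N}))"
  shows "\<forall>i < N. \<forall>j \<le> i. norm (the (mat_inverse A) $$ (i, j)) \<le> M * \<gamma> ^ (i - j)"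
proof (intro allI impI)
  fix i j assume i: "i < N" and ji: "j \<le> i"
  note A = \<open>A \<in> carrier_mat N N\<close>
  define X where "X = the (mat_inverse A)"
  define d where "d = Min ((\<lambda>i. norm (A $$ (i, i))) ` {..<N})"
  have X: "X \<in> carrier_mat N N"
    using the_mat_inverse(1)[OF A \<open>invertible_mat A\<close>] by (simp add: X_def)
  have AX: "A * X = 1\<^sub>m N" and XA: "X * A = 1\<^sub>m N"
    using the_mat_inverse(2,3)[OF A \<open>invertible_mat A\<close>] A X by (auto simp: X_def inverts_mat_def)
  have band: "A $$ (i, k) = 0" if "i < N" "k < N" "i > k + r" for i k
    using \<open>lower_band_mat r A\<close> A that by (auto simp: lower_band_mat_def)
  \<comment> \<open>Column \<open>k\<close> vanishes below row \<open>k + r\<close>, so the truncated sum below the diagonal is a full one.\<close>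
  have dom: "(\<Sum>i \<in> {..<N} - {k}. norm (A $$ (i, k))) \<le> \<mu> * norm (A $$ (k, k))"
    if k: "k < N" for k
  proof -
    have "(\<Sum>i \<in> {..<N} - {k}. norm (A $$ (i, k)))
        = (\<Sum>i \<in> {..<k} \<union> ({k<..k + r} \<inter> {..<N}). norm (A $$ (i, k)))"
      using k by (intro sum.mono_neutral_right) (auto intro!: band)
    also have "\<dots> = (\<Sum>i \<in> {..<k}. norm (A $$ (i, k)))
        + (\<Sum>i \<in> {k<..k + r} \<inter> {..<N}. norm (A $$ (i, k)))"
      by (intro sum.union_disjoint) auto
    finally show ?thesis using dominance k by simp
  qed
  have \<gamma>: "0 \<le> \<gamma>" "\<gamma> \<le> 1" "\<gamma> ^ r = \<mu>"
    using assms(1,2,6,7,9) by (simp_all add: powr_le1 powr_powr flip: powr_realpow)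
  have eq: "(\<Sum>k<N. A $$ (l, k) * X $$ (k, j)) = (if l = j then 1 else 0)" if l: "l < N" for l
  proof -
    have "(A * X) $$ (l, j) = (\<Sum>k<N. A $$ (l, k) * X $$ (k, j))"
      using A X l i ji by (simp add: scalar_prod_def atLeast0LessThan)
    then show ?thesis using AX l i ji by simp
  qed
  have "weighted_tail N (\<lambda>i k. A $$ (i, k)) (\<lambda>k. X $$ (k, j)) i \<le> \<gamma> ^ (i - j) / (1 - \<mu>)"
    using \<open>0 < \<mu>\<close>
    by (intro dominant_band_tail_decay[OF \<open>r > 0\<close> _ \<open>\<mu> < 1\<close> \<gamma> dom band eq]) auto
  then have weighted: "norm (A $$ (i, i)) * norm (X $$ (i, j)) \<le> \<gamma> ^ (i - j) / (1 - \<mu>)"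
    using weighted_entry_le_tail[OF i, of "\<lambda>i k. A $$ (i, k)" "\<lambda>k. X $$ (k, j)"] by simp
  have "d \<in> (\<lambda>i. norm (A $$ (i, i))) ` {..<N}"
    unfolding d_def using i by (intro Min_in) auto
  then have d_pos: "0 < d"
    using dominant_left_invertible_diag_nonzero[OF A X XA dom] by auto
  have "d \<le> norm (A $$ (i, i))"
    unfolding d_def using i by (intro Min_le) auto
  then have "d * norm (X $$ (i, j)) \<le> \<gamma> ^ (i - j) / (1 - \<mu>)"
    using weighted by (meson mult_right_mono norm_ge_zero order_trans)
  then have "norm (X $$ (i, j)) \<le> \<gamma> ^ (i - j) / (1 - \<mu>) / d"
    by (subst pos_le_divide_eq[OF d_pos]) (simp only: mult.commute)
  also have "\<dots> = 1 * (1 / ((1 - \<mu>) * d)) * \<gamma> ^ (i - j)"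
    by simp
  also have "\<dots> \<le> (1 + \<mu>^2) / (1 - \<mu>^2) * (1 / ((1 - \<mu>) * d)) * \<gamma> ^ (i - j)"
  proof (intro mult_right_mono)
    have "\<mu>^2 < 1" using \<open>0 < \<mu>\<close> \<open>\<mu> < 1\<close> by (simp add: power_less_one_iff)
    then show "1 \<le> (1 + \<mu>^2) / (1 - \<mu>^2)" by (simp add: field_simps)
  qed (use \<gamma> \<open>\<mu> < 1\<close> d_pos in auto)
  also have "\<dots> = M * \<gamma> ^ (i - j)"
    unfolding \<open>M = _\<close> d_def[symmetric] by (simp add: mult_ac)
  finally show "norm (the (mat_inverse A) $$ (i, j)) \<le> M * \<gamma> ^ (i - j)"
    by (simp add: X_def)
qed

end
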